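(* Let $n\ge1$ and $p\in\{0,1,2,\dots\}\cup\{+\infty\}$. For every fixed point $\zeta\in\mathbb{T}^n$, the set of functions in $C^p(\mathbb{T}^n)$ that are not real analytic at $\zeta$ is a dense $G_\delta$ subset of $C^p(\mathbb{T}^n)$. Likewise, the set of functions in $C^p(\mathbb{T}^n)$ that are real analytic at no point of $\mathbb{T}^n$ is a dense $G_\delta$ subset of $C^p(\mathbb{T}^n)$.
   Context: $\mathbb{T}$ is the unit circle in $\mathbb{C}$. $C^p(\mathbb{T}^n)$ is the space of functions $f:\mathbb{T}^n\to\mathbb{C}$ whose derivatives $\frac{\partial^{\alpha}f}{\partial\theta^{\alpha}}(e^{i\theta_1},\dots,e^{i\theta_n})=\frac{\partial^{|\alpha|}f}{\partial\theta_1^{a_1}\cdots\partial\theta_n^{a_n}}(e^{i\theta_1},\dots,e^{i\theta_n})$ exist and are continuous on $\mathbb{T}^n$ for all $\alpha=(a_1,\dots,a_n)\in\mathbb{N}^n$ with $|\alpha|=a_1+\cdots+a_n\le p$ (all $\alpha$ if $p=+\infty$). Its topology is given by the seminorms $|f|_\alpha=\sup_{\theta_i\in\mathbb{R}}\left|\frac{\partial^{\alpha}f}{\partial\theta^{\alpha}}(e^{i\theta_1},\dots,e^{i\theta_n})\right|$, $|\alpha|\le p$. A function $f:\mathbb{T}^n\to\mathbb{C}$ is real analytic at $(e^{i\theta_1},\dots,e^{i\theta_n})$, $\theta_i\in\mathbb{R}$, if there are $\delta>0$ and a power series $I(t_1,\dots,t_n)=\sum_{k_1,\dots,k_n\ge0}a_{k_1,\dots,k_n}(t_1-\theta_1)^{k_1}\cdots(t_n-\theta_n)^{k_n}$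 (complex coefficients) converging absolutely and uniformly on $\prod_{i=1}^n[\theta_i-\delta,\theta_i+\delta]$ with $I(t_1,\dots,t_n)=f(e^{it_1},\dots,e^{it_n})$ there. *)

theory Defs
  imports "HOL-Analysis.Analysis" "HOL-Library.Extended_Nat"
begin

text \<open>
  The dimension \<open>n \<ge> 1\<close> is the cardinality of the index type \<open>'n\<close>. The linear order on \<open>'n\<close>
  plays the role of the numbering \<open>1, \<dots>, n\<close> of the coordinates; it is only used to fix the order
  of differentiation in a mixed partial derivative.
\<close>

definition torus :: "(complex ^ 'n) set" where
  "torus = {z. \<forall>i. cmod (z $ i) = 1}"

definition torus_exp :: "real ^ 'n \<Rightarrow> complex ^ 'n" where
  "torus_exp \<theta> = (\<chi> i. cis (\<theta> $ i))"

lemma torus_exp_in_torus [simp]: "torus_exp \<theta> \<in> torus"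
  by (simp add: torus_def torus_exp_def)

lemma range_torus_exp: "range torus_exp = (torus :: (complex ^ 'n) set)"
proof
  show "torus \<subseteq> range (torus_exp :: real ^ 'n \<Rightarrow> complex ^ 'n)"
  proof
    fix z :: "complex ^ 'n" assume "z \<in> torus"
    hence "cis (Arg (z $ i)) = z $ i" for i
      using rcis_cmod_Arg[of "z $ i"] by (simp add: torus_def rcis_def)
    hence "z = torus_exp (\<chi> i. Arg (z $ i))"
      by (simp add: torus_exp_def vec_eq_iff)
    thus "z \<in> range torus_exp" by blast
  qed
qed auto

text \<open>
  Partial derivatives with respect to the angles are again functions on the torus, so they are
  defined at a point of the torus, moving the \<open>j\<close>-th coordinate by the angle \<open>t\<close>. The lemmas
  \<open>angle_differentiable_torus_exp\<close> and \<open>angle_deriv_torus_exp\<close> below say that this is the usual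
  partial derivative of \<open>\<theta> \<mapsto> f (e\<^sup>i\<^sup>\<theta>)\<close> with respect to the \<open>j\<close>-th angle.
\<close>

definition rotate_coord :: "'n \<Rightarrow> real \<Rightarrow> complex ^ 'n \<Rightarrow> complex ^ 'n" where
  "rotate_coord j t z = (\<chi> k. if k = j then cis t * z $ k else z $ k)"

definition angle_differentiable :: "'n \<Rightarrow> (complex ^ 'n \<Rightarrow> complex) \<Rightarrow> complex ^ 'n \<Rightarrow> bool" where
  "angle_differentiable j f z \<longleftrightarrow> (\<lambda>t. f (rotate_coord j t z)) differentiable (at 0)"

definition angle_deriv :: "'n \<Rightarrow> (complex ^ 'n \<Rightarrow> complex) \<Rightarrow> complex ^ 'n \<Rightarrow> complex" where
  "angle_deriv j f z = vector_derivative (\<lambda>t. f (rotate_coord j t z)) (at 0)"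

lemma has_angle_deriv_torus_exp:
  "((\<lambda>t. f (rotate_coord j t (torus_exp \<theta>))) has_vector_derivative D) (at 0) \<longleftrightarrow>
   ((\<lambda>s. f (torus_exp (\<chi> k. if k = j then s else \<theta> $ k))) has_vector_derivative D) (at (\<theta> $ j))"
  (is "(?g has_vector_derivative D) _ \<longleftrightarrow> (?h has_vector_derivative D) _")
proof -
  have rot: "rotate_coord j t (torus_exp \<theta>) =
      torus_exp (\<chi> k. if k = j then \<theta> $ j + t else \<theta> $ k)" for t
    by (auto simp: rotate_coord_def torus_exp_def vec_eq_iff cis_mult add.commute)
  have gh: "?g = ?h \<circ> (\<lambda>t. \<theta> $ j + t)"
    by (simp add: rot o_def)
  have hg: "?h = ?g \<circ> (\<lambda>s. s - \<theta> $ j)"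
    by (simp add: rot o_def cong: if_cong)
  have shift: "((\<lambda>t. \<theta> $ j + t) has_vector_derivative 1) (at 0)"
    "((\<lambda>s. s - \<theta> $ j) has_vector_derivative 1) (at (\<theta> $ j))"
    by (auto intro!: derivative_eq_intros)
  show ?thesis
  proof
    assume "(?g has_vector_derivative D) (at 0)"
    then show "(?h has_vector_derivative D) (at (\<theta> $ j))"
      using vector_diff_chain_at[OF shift(2), of ?g D] unfolding hg by simp
  next
    assume "(?h has_vector_derivative D) (at (\<theta> $ j))"
    then show "(?g has_vector_derivative D) (at 0)"
      using vector_diff_chain_at[OF shift(1), of ?h D] unfolding gh by simp
  qed
qed

lemma angle_differentiable_torus_exp:
  "angle_differentiable j f (torus_exp \<theta>) \<longleftrightarrow>
   (\<lambda>s. f (torus_exp (\<chi> k. if k = j then s else \<theta> $ k))) differentiable (at (\<theta> $ j))"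
proof -
  have ex: "h differentiable (at x) \<longleftrightarrow> (\<exists>D. (h has_vector_derivative D) (at x))"
    for h :: "real \<Rightarrow> complex" and x
    using vector_derivative_works differentiableI_vector by blast
  show ?thesis
    unfolding angle_differentiable_def ex has_angle_deriv_torus_exp ..
qed

lemma angle_deriv_torus_exp:
  "angle_deriv j f (torus_exp \<theta>) =
   vector_derivative (\<lambda>s. f (torus_exp (\<chi> k. if k = j then s else \<theta> $ k))) (at (\<theta> $ j))"
  unfolding angle_deriv_def vector_derivative_def by (simp add: has_angle_deriv_torus_exp)

text \<open>
  In a list of directions the head is the outermost (last performed) differentiation. The list
  attached to the multi-index \<open>\<alpha>\<close> has \<open>\<alpha> 1\<close> copies of \<open>1\<close> first and \<open>\<alpha> n\<close> copies of \<open>n\<close> last,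
  matching the notation for the derivative with respect to
  \<open>\<theta>\<^sub>1\<close> (\<open>\<alpha> 1\<close> times), \<open>\<dots>\<close>, \<open>\<theta>\<^sub>n\<close> (\<open>\<alpha> n\<close> times).
\<close>

primrec angle_derivs :: "'n list \<Rightarrow> (complex ^ 'n \<Rightarrow> complex) \<Rightarrow> complex ^ 'n \<Rightarrow> complex" where
  "angle_derivs [] f = f"
| "angle_derivs (j # js) f = angle_deriv j (angle_derivs js f)"

primrec has_angle_derivs :: "'n list \<Rightarrow> (complex ^ 'n \<Rightarrow> complex) \<Rightarrow> bool" where
  "has_angle_derivs [] f \<longleftrightarrow> True"
| "has_angle_derivs (j # js) f \<longleftrightarrow>
     has_angle_derivs js f \<and> (\<forall>z\<in>torus. angle_differentiable j (angle_derivs js f) z)"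

definition directions :: "('n::{finite,linorder} \<Rightarrow> nat) \<Rightarrow> 'n list" where
  "directions \<alpha> = concat (map (\<lambda>i. replicate (\<alpha> i) i) (sorted_list_of_set UNIV))"

abbreviation multi_deriv ::
    "('n::{finite,linorder} \<Rightarrow> nat) \<Rightarrow> (complex ^ 'n::{finite,linorder} \<Rightarrow> complex) \<Rightarrow> complex ^ 'n::{finite,linorder} \<Rightarrow> complex" where
  "multi_deriv \<alpha> \<equiv> angle_derivs (directions \<alpha>)"

abbreviation has_multi_deriv ::
    "('n::{finite,linorder} \<Rightarrow> nat) \<Rightarrow> (complex ^ 'n::{finite,linorder} \<Rightarrow> complex) \<Rightarrow> bool" where
  "has_multi_deriv \<alpha> \<equiv> has_angle_derivs (directions \<alpha>)"

definition multi_indices :: "enat \<Rightarrow> ('n::finite \<Rightarrow> nat) set" where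
  "multi_indices p = {\<alpha>. enat (\<Sum>i\<in>UNIV. \<alpha> i) \<le> p}"

text \<open>
  A function on the torus is represented by its extension with value \<open>undefined\<close> off the torus,
  so that equality in \<open>Cp p\<close> is equality on the torus.
\<close>

definition Cp :: "enat \<Rightarrow> (complex ^ 'n::{finite,linorder} \<Rightarrow> complex) set" where
  "Cp p = {f \<in> extensional torus.
     \<forall>\<alpha>\<in>multi_indices p. has_multi_deriv \<alpha> f \<and> continuous_on torus (multi_deriv \<alpha> f)}"

definition Cp_seminorm ::
    "('n::{finite,linorder} \<Rightarrow> nat) \<Rightarrow> (complex ^ 'n::{finite,linorder} \<Rightarrow> complex) \<Rightarrow> real" where
  "Cp_seminorm \<alpha> f = (SUP \<theta>. cmod (multi_deriv \<alpha> f (torus_exp \<theta>)))"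

definition Cp_topology :: "enat \<Rightarrow> (complex ^ 'n::{finite,linorder} \<Rightarrow> complex) topology" where
  "Cp_topology p = topology_generated_by
     {{g \<in> Cp p. Cp_seminorm \<alpha> (\<lambda>z. g z - f z) < \<epsilon>} | f \<alpha> \<epsilon>.
        f \<in> Cp p \<and> \<alpha> \<in> multi_indices p \<and> \<epsilon> > 0}"

lemma topspace_Cp_topology [simp]: "topspace (Cp_topology p) = Cp p"
proof -
  have zero: "f \<in> {g \<in> Cp p. Cp_seminorm (\<lambda>_. 0) (\<lambda>z. g z - f z) < 1}" if "f \<in> Cp p"
    for f :: "complex ^ 'n::{finite,linorder} \<Rightarrow> complex"
  proof -
    have "directions (\<lambda>_::'n. 0) = []" by (simp add: directions_def)
    with that show ?thesis by (simp add: Cp_seminorm_def)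
  qed
  have "(\<lambda>_. 0) \<in> multi_indices p"
    by (simp add: multi_indices_def zero_enat_def [symmetric])
  then have "f \<in> topspace (Cp_topology p)" if "f \<in> Cp p"
    for f :: "complex ^ 'n::{finite,linorder} \<Rightarrow> complex"
    unfolding Cp_topology_def topology_generated_by_topspace
    using that zero[OF that]
    by (intro UnionI[of "{g \<in> Cp p. Cp_seminorm (\<lambda>_. 0) (\<lambda>z. g z - f z) < 1}"] CollectI
        exI[of _ f] exI[of _ "\<lambda>_. 0"] exI[of _ 1]) auto
  then show ?thesis
    unfolding Cp_topology_def topology_generated_by_topspace by auto
qed

text \<open>
  Since \<open>\<theta>\<close> is determined by \<open>\<zeta>\<close> up to multiples of \<open>2\<pi>\<close> in each coordinate, the choice of
  \<open>\<theta>\<close> below is immaterial.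
\<close>

definition power_series_term ::
    "(('n::finite \<Rightarrow> nat) \<Rightarrow> complex) \<Rightarrow> real ^ 'n \<Rightarrow> real ^ 'n \<Rightarrow> ('n \<Rightarrow> nat) \<Rightarrow> complex" where
  "power_series_term a \<theta> t k = a k * of_real (\<Prod>i\<in>UNIV. (t $ i - \<theta> $ i) ^ k i)"

definition real_analytic_at_torus ::
    "(complex ^ 'n::finite \<Rightarrow> complex) \<Rightarrow> complex ^ 'n \<Rightarrow> bool" where
  "real_analytic_at_torus f \<zeta> \<longleftrightarrow>
     (\<exists>\<theta> \<delta> a. \<zeta> = torus_exp \<theta> \<and> \<delta> > 0 \<and>
        (let B = cbox (\<chi> i. \<theta> $ i - \<delta>) (\<chi> i. \<theta> $ i + \<delta>);
             I = (\<lambda>t. \<Sum>\<^sub>\<infinity>k. power_series_term a \<theta> t k)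
         in (\<forall>t\<in>B. (\<lambda>k. norm (power_series_term a \<theta> t k)) summable_on UNIV) \<and>
            uniform_limit B (\<lambda>F t. \<Sum>k\<in>F. power_series_term a \<theta> t k) I
              (finite_subsets_at_top UNIV) \<and>
            (\<forall>t\<in>B. I t = f (torus_exp t))))"

definition dense_Gdelta_in :: "'a topology \<Rightarrow> 'a set \<Rightarrow> bool" where
  "dense_Gdelta_in X S \<longleftrightarrow> gdelta_in X S \<and> X closure_of S = topspace X"

end

theory Submission
  imports Defs "HOL-Complex_Analysis.Cauchy_Integral_Formula" "HOL-Real_Asymp.Real_Asymp"
begin

text \<open>
  The functions that are analytic at some point of a compact set of angles form an
  \<open>F\<^sub>\<sigma>\<close>: if \<open>f\<close> is analytic at \<open>\<theta>\<close>, then for some \<open>M\<close> the Taylor coefficients at \<open>\<theta>\<close> are bounded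
  by \<open>M\<^bsup>\<bar>k\<bar>+1\<^esup>\<close> and the series represents \<open>f\<close> on the box of radius \<open>1 / (2 M)\<close> around \<open>\<theta>\<close>. For
  fixed \<open>M\<close> this condition survives uniform limits, even when the centre \<open>\<theta>\<close> varies in a compact
  set, because centres and coefficient families range over a compact metrizable space and the
  geometric bound allows limits under the sum (\<open>power_series_bounded_by_limit\<close>). Taking for the
  compact set a single point or a full period box gives the two \<open>G\<^sub>\<delta>\<close> claims.

  Density follows by perturbing along a single direction \<open>g\<close>, itself nowhere analytic. The lacunary
  series \<open>g(z) = \<Sum>\<^sub>k 4\<^bsup>-k\<^sup>2\<^esup> z\<^sub>j\<^bsup>4^k\<^esup>\<close> is smooth on the torus, but at every point its
  derivative of order \<open>2 m\<close> in the \<open>j\<close>-th angle has size at least \<open>4\<^bsup>m\<^sup>2\<^esup> / 3\<close>, which beats every bound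
  \<open>C r\<^bsup>-2m\<^esup> (2m)!\<close>; hence \<open>g\<close>, as a function of the \<open>j\<close>-th angle, extends holomorphically to no disc
  around a real point (\<open>lacunary_no_holomorphic_extension\<close>). Now let \<open>f\<close> be arbitrary and suppose that
  \<open>f + c g\<close> is analytic somewhere for every \<open>c\<close> in an interval. Each of these uncountably many
  functions is represented by a power series on some box, and each box contains a point of a fixed
  countable dense set, so two different \<open>c\<close>, \<open>c'\<close> share such a point \<open>q\<close>. On the line through \<open>q\<close> in
  direction \<open>j\<close> both power series extend holomorphically near \<open>q\<close>, hence so does
  \<open>(c - c') g\<close>, a contradiction. So arbitrarily small \<open>c\<close> make \<open>f + c g\<close> nowhere analytic.
\<close>

section \<open>A lacunary series that is smooth and nowhere analytic on the circle\<close>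

text \<open>
  For \<open>u = e\<^sup>i\<^sup>t\<close> this is the \<open>m\<close>-th derivative with respect to \<open>t\<close> of the case \<open>m = 0\<close>. The exponent
  \<open>k\<^sup>2\<close> is chosen so that the factors \<open>4\<^bsup>km\<^esup>\<close> produced by \<open>m\<close> differentiations do not destroy
  convergence, while still letting the largest term grow faster than any \<open>C\<^sup>m m!\<close>.
\<close>

definition lacunary :: "nat \<Rightarrow> complex \<Rightarrow> complex" where
  "lacunary m u = (\<Sum>k. (1/4) ^ k\<^sup>2 * (\<i> * 4 ^ k) ^ m * u ^ (4 ^ k))"

lemma norm_lacunary_term:
  assumes "cmod u = 1"
  shows "norm ((1/4) ^ k\<^sup>2 * (\<i> * 4 ^ k) ^ m * u ^ (4 ^ k)) = (1/4) ^ k\<^sup>2 * 4 ^ (k * m)"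
  using assms by (simp add: norm_mult norm_power norm_divide power_mult_distrib power_mult)

lemma summable_lacunary_majorant: "summable (\<lambda>k. (1/4::real) ^ k\<^sup>2 * 4 ^ (k * m))"
proof (rule summable_comparison_test')
  show "summable (\<lambda>k. (1/4::real) ^ k)"
    by (rule summable_geometric) simp
  fix k :: nat assume "k \<ge> Suc m"
  then have "k * m + k \<le> k\<^sup>2"
    unfolding power2_eq_square using mult_le_mono2[of "Suc m" k k] by simp
  then have "(4::real) ^ (k * m + k) \<le> 4 ^ k\<^sup>2"
    by (intro power_increasing) auto
  then show "norm ((1/4::real) ^ k\<^sup>2 * 4 ^ (k * m)) \<le> (1/4) ^ k"
    by (simp add: field_simps power_add)
qed

lemma uniform_limit_lacunary:
  "uniform_limit {u. cmod u = 1} (\<lambda>N u. \<Sum>k<N. (1/4) ^ k\<^sup>2 * (\<i> * 4 ^ k) ^ m * u ^ (4 ^ k))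
     (lacunary m) sequentially"
  unfolding lacunary_def [abs_def]
  by (rule Weierstrass_m_test[OF _ summable_lacunary_majorant[of m]])
     (simp only: mem_Collect_eq norm_lacunary_term)

lemma sums_lacunary:
  assumes "cmod u = 1"
  shows "(\<lambda>k. (1/4) ^ k\<^sup>2 * (\<i> * 4 ^ k) ^ m * u ^ (4 ^ k)) sums lacunary m u"
  unfolding lacunary_def
proof (rule summable_sums, rule summable_norm_cancel)
  show "summable (\<lambda>k. norm ((1/4) ^ k\<^sup>2 * (\<i> * 4 ^ k) ^ m * u ^ (4 ^ k)))"
    unfolding norm_lacunary_term[OF assms] by (rule summable_lacunary_majorant)
qed

lemma continuous_on_lacunary: "continuous_on {u. cmod u = 1} (lacunary m)"
  by (rule uniform_limit_theorem[OF _ uniform_limit_lacunary])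
     (auto intro!: always_eventually continuous_intros)

lemma lacunary_has_vector_derivative:
  "((\<lambda>t. lacunary m (cis t)) has_vector_derivative lacunary (Suc m) (cis t)) (at t)"
proof -
  let ?c = "\<lambda>m k u. (1/4::complex) ^ k\<^sup>2 * (\<i> * 4 ^ k) ^ m * u ^ (4 ^ k)"
  have deriv_term: "((\<lambda>t. ?c m k (cis t)) has_derivative (\<lambda>h. h *\<^sub>R ?c (Suc m) k (cis t))) (at t within UNIV)"
    for k t
  proof -
    have "((\<lambda>w. ?c m k (exp (\<i> * w))) has_field_derivative ?c (Suc m) k (exp (\<i> * of_real t)))
        (at (of_real t))"
      unfolding exp_of_nat_mult [symmetric]
      by (auto intro!: derivative_eq_intros)
    from has_vector_derivative_real_field[OF this] show ?thesis
      by (simp add: cis_conv_exp has_vector_derivative_def)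
  qed
  have "\<exists>g. \<forall>t\<in>UNIV. (\<lambda>k. ?c m k (cis t)) sums g t \<and>
      (g has_derivative (\<lambda>h. h *\<^sub>R lacunary (Suc m) (cis t))) (at t within UNIV)"
  proof (rule has_derivative_series[where f' = "\<lambda>k t h. h *\<^sub>R ?c (Suc m) k (cis t)"])
    show "(\<lambda>k. ?c m k (cis 0)) sums lacunary m (cis 0)"
      by (rule sums_lacunary) simp
    fix e :: real assume "e > 0"
    from uniform_limitD[OF uniform_limit_lacunary[of "Suc m"] this]
    show "\<forall>\<^sub>F n in sequentially. \<forall>t\<in>UNIV. \<forall>h.
        norm ((\<Sum>k<n. h *\<^sub>R ?c (Suc m) k (cis t)) - h *\<^sub>R lacunary (Suc m) (cis t)) \<le> e * norm h"
    proof (rule eventually_mono, intro ballI allI)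
      fix n t h
      assume "\<forall>u\<in>{u. cmod u = 1}. dist (\<Sum>k<n. ?c (Suc m) k u) (lacunary (Suc m) u) < e"
      then have "norm ((\<Sum>k<n. ?c (Suc m) k (cis t)) - lacunary (Suc m) (cis t)) \<le> e"
        by (simp add: dist_norm less_imp_le)
      then have "norm (h *\<^sub>R ((\<Sum>k<n. ?c (Suc m) k (cis t)) - lacunary (Suc m) (cis t))) \<le> e * norm h"
        unfolding norm_scaleR mult.commute[of e] real_norm_def by (rule mult_left_mono) simp
      then show "norm ((\<Sum>k<n. h *\<^sub>R ?c (Suc m) k (cis t)) - h *\<^sub>R lacunary (Suc m) (cis t)) \<le> e * norm h"
        by (simp only: scaleR_sum_right scaleR_diff_right)
    qed
  qed (use deriv_term in auto)
  then obtain g where g: "\<And>t. (\<lambda>k. ?c m k (cis t)) sums g t"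
      "\<And>t. (g has_derivative (\<lambda>h. h *\<^sub>R lacunary (Suc m) (cis t))) (at t)"
    by auto
  have "g = (\<lambda>t. lacunary m (cis t))"
    using sums_unique2[OF g(1) sums_lacunary] by auto
  with g(2) show ?thesis
    by (simp add: has_vector_derivative_def)
qed

text \<open>
  The term of index \<open>k\<close> has modulus \<open>4\<^bsup>j\<^sup>2\<^esup> 4\<^bsup>-(k-j)\<^sup>2\<^esup>\<close>, by completing the square. So the term
  \<open>k = j\<close> dominates: the terms on either side of it sum to at most a third of its modulus.
  Since moduli do not depend on \<open>u\<close>, the bound holds at every point of the circle.
\<close>

lemma norm_lacunary_even_ge:
  assumes u: "cmod u = 1"
  shows "4 ^ j\<^sup>2 / 3 \<le> norm (lacunary (2 * j) u)"
proof -
  define c where "c k = (1/4::complex) ^ k\<^sup>2 * (\<i> * 4 ^ k) ^ (2 * j) * u ^ (4 ^ k)" for k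
  have norm_c: "norm (c k) = 4 ^ j\<^sup>2 * (1/4) ^ d\<^sup>2" if "k = j + d \<or> j = k + d" for k d
  proof -
    have "k * (2 * j) + d\<^sup>2 = j\<^sup>2 + k\<^sup>2"
      using that by (auto simp: power2_eq_square algebra_simps)
    then have "(4::real) ^ (k * (2 * j)) * 4 ^ d\<^sup>2 = 4 ^ j\<^sup>2 * 4 ^ k\<^sup>2"
      by (metis power_add)
    then show ?thesis
      unfolding c_def norm_lacunary_term[OF u] by (simp add: field_simps)
  qed
  have bound: "norm (c k) \<le> 4 ^ j\<^sup>2 * (1/4) ^ d" if "k = j + d \<or> j = k + d" for k d
    unfolding norm_c[OF that] by (intro mult_left_mono power_decreasing) (auto simp: power2_eq_square)
  have geo: "(\<lambda>i. 4 ^ j\<^sup>2 * (1/4::real) ^ Suc i) sums (4 ^ j\<^sup>2 * (1/3))"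
    using sums_mult[OF sums_mult[OF geometric_sums[of "1/4::real"]], of "4 ^ j\<^sup>2" "1/4"] by simp
  have sumc: "c sums lacunary (2 * j) u"
    unfolding c_def by (rule sums_lacunary[OF u])
  then have tail: "(\<lambda>i. c (i + Suc j)) sums (lacunary (2 * j) u - (\<Sum>i<Suc j. c i))"
    by (rule sums_split_initial_segment)
  have tail_le: "norm (lacunary (2 * j) u - (\<Sum>i<Suc j. c i)) \<le> 4 ^ j\<^sup>2 * (1/3)"
  proof -
    have le: "norm (c (i + Suc j)) \<le> 4 ^ j\<^sup>2 * (1/4) ^ Suc i" for i
      by (rule bound) simp
    have sm: "summable (\<lambda>i. norm (c (i + Suc j)))"
      by (rule summable_comparison_test'[OF sums_summable[OF geo]]) (use le in auto)
    have "norm (\<Sum>i. c (i + Suc j)) \<le> (\<Sum>i. norm (c (i + Suc j)))"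
      by (rule summable_norm[OF sm])
    also have "\<dots> \<le> (\<Sum>i. 4 ^ j\<^sup>2 * (1/4::real) ^ Suc i)"
      by (rule suminf_le[OF le sm sums_summable[OF geo]])
    finally show ?thesis
      using sums_unique[OF tail] sums_unique[OF geo] by simp
  qed
  have head_le: "norm (\<Sum>i<j. c i) \<le> 4 ^ j\<^sup>2 * (1/3)"
  proof -
    have "norm (\<Sum>i<j. c i) \<le> (\<Sum>i<j. 4 ^ j\<^sup>2 * (1/4) ^ (j - i))"
      by (rule sum_norm_le, rule bound) auto
    also have "\<dots> = (\<Sum>i<j. 4 ^ j\<^sup>2 * (1/4) ^ Suc i)"
      by (rule sum.reindex_bij_witness[where i = "\<lambda>i. j - Suc i" and j = "\<lambda>i. j - Suc i"])
         (auto simp: Suc_diff_Suc simp del: power_Suc)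
    also have "\<dots> \<le> (\<Sum>i. 4 ^ j\<^sup>2 * (1/4) ^ Suc i)"
      by (rule sum_le_suminf[OF sums_summable[OF geo]]) auto
    finally show ?thesis
      using sums_unique[OF geo] by simp
  qed
  have "c j = lacunary (2 * j) u - (lacunary (2 * j) u - (\<Sum>i<Suc j. c i)) - (\<Sum>i<j. c i)"
    by simp
  then have "norm (c j) \<le> norm (lacunary (2 * j) u)
      + norm (lacunary (2 * j) u - (\<Sum>i<Suc j. c i)) + norm (\<Sum>i<j. c i)"
    by (metis (no_types, lifting) norm_triangle_ineq4 add_right_mono order_trans)
  moreover have "norm (c j) = 4 ^ j\<^sup>2"
    using norm_c[of j 0] by simp
  ultimately show ?thesis
    using tail_le head_le by simp
qed

text \<open>
  A holomorphic extension \<open>H\<close> would have the values of \<open>lacunary m\<close> as its derivatives at the centre,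
  and Cauchy's inequality bounds these by \<open>m! B / \<rho>\<^sup>m\<close>, too small for \<open>m = 2 j\<close> and large \<open>j\<close>.
\<close>

lemma lacunary_no_holomorphic_extension:
  assumes "r > 0" and hol: "H holomorphic_on ball (of_real x) r"
    and eq: "\<And>t. \<bar>t - x\<bar> < r \<Longrightarrow> H (of_real t) = lacunary 0 (cis t)"
  shows False
proof -
  have ball: "of_real t \<in> ball (of_real x :: complex) r \<longleftrightarrow> \<bar>t - x\<bar> < r" for t
    by (simp add: dist_of_real dist_real_def abs_minus_commute)
  have deriv_eq: "(deriv ^^ m) H (of_real t) = lacunary m (cis t)" if "\<bar>t - x\<bar> < r" for m t
    using that
  proof (induction m arbitrary: t)
    case 0
    then show ?case by (simp add: eq)
  next
    case (Suc m)
    have "(deriv ^^ m) H holomorphic_on ball (of_real x) r"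
      by (rule holomorphic_higher_deriv[OF hol]) simp
    then have "((deriv ^^ m) H has_field_derivative (deriv ^^ Suc m) H (of_real t)) (at (of_real t))"
      using holomorphic_derivI[OF _ open_ball] Suc.prems ball by auto
    from has_vector_derivative_real_field[OF this]
    have 1: "((\<lambda>s. (deriv ^^ m) H (of_real s)) has_vector_derivative (deriv ^^ Suc m) H (of_real t)) (at t)" .
    have "((\<lambda>s. lacunary m (cis s)) has_vector_derivative (deriv ^^ Suc m) H (of_real t)) (at t)"
    proof (rule has_vector_derivative_transform_within_open[OF 1])
      show "open (ball x r)" "t \<in> ball x r"
        using Suc.prems by (auto simp: dist_real_def abs_minus_commute)
      show "(deriv ^^ m) H (of_real s) = lacunary m (cis s)" if "s \<in> ball x r" for s
        using that Suc.IH by (simp add: dist_real_def abs_minus_commute)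
    qed
    from vector_derivative_unique_at[OF this lacunary_has_vector_derivative] show ?case .
  qed
  \<comment> \<open>A smaller radius, so that the extension is bounded on the closed disc.\<close>
  define \<rho> where "\<rho> = r / 2"
  have rho: "\<rho> > 0" "\<rho> < r" using \<open>r > 0\<close> by (auto simp: \<rho>_def)
  have sub: "cball (of_real x :: complex) \<rho> \<subseteq> ball (of_real x) r"
    using rho by auto
  have cont: "continuous_on (cball (of_real x) \<rho>) H"
    using holomorphic_on_imp_continuous_on[OF hol] sub by (rule continuous_on_subset)
  then have "bounded (H ` cball (of_real x) \<rho>)"
    by (intro compact_imp_bounded compact_continuous_image) auto
  then obtain B where B: "\<And>w. w \<in> cball (of_real x) \<rho> \<Longrightarrow> norm (H w) \<le> B"
    unfolding bounded_iff by blast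
  have bound: "4 ^ j\<^sup>2 / 3 \<le> fact (2 * j) * B / \<rho> ^ (2 * j)" for j :: nat
  proof -
    have "norm ((deriv ^^ (2 * j)) H (of_real x)) \<le> fact (2 * j) * B / \<rho> ^ (2 * j)"
    proof (rule Cauchy_inequality[OF _ cont rho(1)])
      show "H holomorphic_on ball (of_real x) \<rho>"
        by (rule holomorphic_on_subset[OF hol]) (use rho in auto)
      show "norm (H w) \<le> B" if "norm (of_real x - w) = \<rho>" for w
        using that by (intro B) (simp add: dist_norm)
    qed
    moreover have "(deriv ^^ (2 * j)) H (of_real x) = lacunary (2 * j) (cis x)"
      using \<open>r > 0\<close> by (intro deriv_eq) simp
    ultimately have "norm (lacunary (2 * j) (cis x)) \<le> fact (2 * j) * B / \<rho> ^ (2 * j)"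
      by simp
    with norm_lacunary_even_ge[OF norm_cis] show ?thesis
      by (rule order_trans)
  qed
  define b where "b = \<bar>B\<bar> + 1"
  have "4 ^ j\<^sup>2 / 3 \<le> (2 * real j) ^ (2 * j) * b / \<rho> ^ (2 * j)" for j :: nat
  proof -
    have "fact (2 * j) \<le> (2 * real j) ^ (2 * j)"
      using fact_le_power[of "2 * j", where ?'a = real] by simp
    then have "fact (2 * j) * B \<le> (2 * real j) ^ (2 * j) * b"
      by (intro order_trans[OF mult_left_mono[of B b] mult_right_mono]) (auto simp: b_def)
    then have "fact (2 * j) * B / \<rho> ^ (2 * j) \<le> (2 * real j) ^ (2 * j) * b / \<rho> ^ (2 * j)"
      using rho(1) by (intro divide_right_mono) auto
    with bound[of j] show ?thesis by linarith
  qed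
  then have "\<forall>\<^sub>F j in sequentially. 4 ^ j\<^sup>2 / 3 \<le> (2 * real j) ^ (2 * j) * b / \<rho> ^ (2 * j)"
    by (rule always_eventually[OF allI])
  moreover have "\<forall>\<^sub>F j::nat in sequentially. 4 ^ j\<^sup>2 / 3 > (2 * real j) ^ (2 * j) * b / \<rho> ^ (2 * j)"
  proof -
    have "\<forall>\<^sub>F j::nat in sequentially. 4 * real j / \<rho> \<le> 2 ^ j"
      using rho(1) by real_asymp
    moreover have "\<forall>\<^sub>F j::nat in sequentially. 3 * b < 4 ^ j"
      by real_asymp
    ultimately show ?thesis
    proof eventually_elim
      case (elim j)
      have "(4 * real j / \<rho>) ^ (2 * j) \<le> (2 ^ j) ^ (2 * j)"
        using elim(1) rho(1) by (intro power_mono) auto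
      also have "((2::real) ^ j) ^ (2 * j) = (2 ^ 2) ^ j\<^sup>2"
        unfolding power_mult [symmetric] by (simp only: power2_eq_square mult_ac)
      also have "(2 ^ 2 :: real) = 4" by simp
      also have "(4 * real j / \<rho>) ^ (2 * j) = (2 * real j) ^ (2 * j) / \<rho> ^ (2 * j) * 4 ^ j"
        using power_mult_distrib[of "4::real" 4 j]
        by (simp add: power_mult power_divide power_mult_distrib)
      finally have "(2 * real j) ^ (2 * j) / \<rho> ^ (2 * j) * 4 ^ j \<le> 4 ^ j\<^sup>2" .
      then have le: "(2 * real j) ^ (2 * j) / \<rho> ^ (2 * j) \<le> 4 ^ j\<^sup>2 / 4 ^ j"
        by (simp add: field_simps)
      have "(2 * real j) ^ (2 * j) / \<rho> ^ (2 * j) * b \<le> 4 ^ j\<^sup>2 / 4 ^ j * b"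
        by (rule mult_right_mono[OF le]) (simp add: b_def)
      also have "\<dots> < 4 ^ j\<^sup>2 / 3"
        using elim(2) by (simp add: field_simps)
      finally show ?case by (simp add: mult_ac)
    qed
  qed
  ultimately have "\<forall>\<^sub>F j::nat in sequentially. False"
    by eventually_elim linarith
  then show False by simp
qed

section \<open>Power series with geometrically bounded coefficients\<close>

lemma torus_exp_eq_imp_shift:
  "torus_exp \<theta> = torus_exp \<theta>' \<Longrightarrow> torus_exp (\<theta> + s) = torus_exp (\<theta>' + s)"
  by (simp add: torus_exp_def vec_eq_iff flip: cis_mult)

text \<open>
  The sum is a product of geometric series, one for each coordinate.
\<close>

lemma summable_on_multi_geometric:
  fixes x :: real
  assumes "0 \<le> x" "x < 1"
  shows "(\<lambda>k :: 'n::finite \<Rightarrow> nat. x ^ sum k UNIV) summable_on UNIV"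
proof -
  have "Infinite_Set_Sum.abs_summable_on (\<lambda>m. x ^ m) UNIV"
    unfolding abs_summable_on_nat_iff' using assms by (simp add: summable_geometric)
  then have "Infinite_Set_Sum.abs_summable_on (\<lambda>k. \<Prod>i\<in>UNIV. x ^ k i) (PiE UNIV (\<lambda>_::'n. UNIV :: nat set))"
    by (intro abs_summable_on_prod_PiE) auto
  then have "Infinite_Set_Sum.abs_summable_on (\<lambda>k :: 'n \<Rightarrow> nat. x ^ sum k UNIV) UNIV"
    by (simp add: power_sum)
  then show ?thesis
    using assms by (simp flip: abs_summable_equivalent)
qed

text \<open>
  Real analyticity at \<open>\<theta>\<close> with quantitative control: one natural number bounds both the growth of
  the coefficients and, from below, the size of the box. The factor \<open>2\<close> in the box makes the series
  converge there with a geometric majorant that depends only on \<open>M\<close>. The point moves as \<open>\<theta> + s\<close>,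
  so that the series itself does not involve the centre.
\<close>

definition power_series_bounded_by ::
    "nat \<Rightarrow> (complex ^ 'n::finite \<Rightarrow> complex) \<Rightarrow> real ^ 'n \<Rightarrow> (('n \<Rightarrow> nat) \<Rightarrow> complex) \<Rightarrow> bool" where
  "power_series_bounded_by M f \<theta> a \<longleftrightarrow>
     (\<forall>k. norm (a k) \<le> real M ^ Suc (sum k UNIV)) \<and>
     (\<forall>s. (\<forall>i. \<bar>s $ i\<bar> \<le> 1 / (2 * real M)) \<longrightarrow>
        (\<Sum>\<^sub>\<infinity>k. power_series_term a 0 s k) = f (torus_exp (\<theta> + s)))"

text \<open>
  The displacements are not restricted to real numbers, because one of the coordinates serves as
  a complex variable when the series is extended off the real line.
\<close>

lemma geometric_majorant:
  fixes a :: "('n::finite \<Rightarrow> nat) \<Rightarrow> complex" and w :: "'n \<Rightarrow> 'b::real_normed_field"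
  assumes "norm (a k) \<le> real M ^ Suc (sum k UNIV)" "M > 0"
    and "\<And>i. norm (w i) \<le> 1 / (2 * real M)"
  shows "norm (a k) * norm (\<Prod>i\<in>UNIV. w i ^ k i) \<le> real M * (1/2) ^ sum k UNIV"
proof -
  have "norm (\<Prod>i\<in>UNIV. w i ^ k i) \<le> (\<Prod>i\<in>UNIV. (1 / (2 * real M)) ^ k i)"
    unfolding prod_norm [symmetric] norm_power
    by (intro prod_mono conjI power_mono assms) auto
  also have "\<dots> = (1 / (2 * real M)) ^ sum k UNIV"
    by (simp add: power_sum)
  finally have "norm (a k) * norm (\<Prod>i\<in>UNIV. w i ^ k i)
      \<le> real M ^ Suc (sum k UNIV) * (1 / (2 * real M)) ^ sum k UNIV"
    by (intro mult_mono assms) auto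
  also have "\<dots> = real M * (1/2) ^ sum k UNIV"
    using \<open>M > 0\<close> by (simp add: power_divide power_mult_distrib)
  finally show ?thesis .
qed

lemma norm_power_series_term_le:
  assumes "norm (a k) \<le> real M ^ Suc (sum k UNIV)" "M > 0"
    and "\<And>i. \<bar>s $ i\<bar> \<le> 1 / (2 * real M)"
  shows "norm (power_series_term a 0 s k) \<le> real M * (1/2) ^ sum k UNIV"
  using geometric_majorant[of a k M "\<lambda>i. complex_of_real (s $ i)", OF assms(1,2)] assms(3)
  by (simp add: power_series_term_def norm_mult)

lemma summable_on_geometric_majorant:
  "(\<lambda>k :: 'n::finite \<Rightarrow> nat. real M * (1/2) ^ sum k UNIV) summable_on UNIV"
  by (intro summable_on_cmult_right summable_on_multi_geometric) auto

text \<open>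
  Absolute convergence at the corner \<open>\<theta> + (\<delta>, \<dots>, \<delta>)\<close> bounds \<open>\<bar>a\<^sub>k\<bar> \<delta>\<^bsup>\<bar>k\<bar>\<^esup>\<close>, which gives \<open>M\<close>; conversely the
  geometric majorant gives absolute and, by the Weierstrass test, uniform convergence. In
  particular the choice of the angle that represents a point is immaterial.
\<close>

lemma real_analytic_at_torus_iff_bounded:
  fixes f :: "complex ^ 'n::finite \<Rightarrow> complex"
  shows "real_analytic_at_torus f (torus_exp \<theta>) \<longleftrightarrow>
    (\<exists>m a. power_series_bounded_by (Suc m) f \<theta> a)"
proof
  assume "real_analytic_at_torus f (torus_exp \<theta>)"
  then obtain \<theta>' \<delta> a where eq: "torus_exp \<theta> = torus_exp \<theta>'" and "\<delta> > 0"
    and summable: "\<And>t. t \<in> cbox (\<chi> i. \<theta>' $ i - \<delta>) (\<chi> i. \<theta>' $ i + \<delta>) \<Longrightarrow>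
      (\<lambda>k. norm (power_series_term a \<theta>' t k)) summable_on UNIV"
    and f: "\<And>t. t \<in> cbox (\<chi> i. \<theta>' $ i - \<delta>) (\<chi> i. \<theta>' $ i + \<delta>) \<Longrightarrow>
      (\<Sum>\<^sub>\<infinity>k. power_series_term a \<theta>' t k) = f (torus_exp t)"
    unfolding real_analytic_at_torus_def Let_def by blast
  define C where "C = (\<Sum>\<^sub>\<infinity>k. norm (power_series_term a \<theta>' (\<chi> i. \<theta>' $ i + \<delta>) k))"
  have bound: "norm (a k) * \<delta> ^ sum k UNIV \<le> C" for k
  proof -
    have "(\<Sum>k\<in>{k}. norm (power_series_term a \<theta>' (\<chi> i. \<theta>' $ i + \<delta>) k)) \<le> C"
      unfolding C_def using \<open>\<delta> > 0\<close>
      by (intro finite_sum_le_infsum summable) (auto simp: mem_box_cart)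
    moreover have "norm (power_series_term a \<theta>' (\<chi> i. \<theta>' $ i + \<delta>) k) = norm (a k) * \<delta> ^ sum k UNIV"
      using \<open>\<delta> > 0\<close> by (simp add: power_series_term_def norm_mult norm_power power_sum flip: prod_norm)
    ultimately show ?thesis by simp
  qed
  obtain m :: nat where "max C (1 / \<delta>) < real m"
    using reals_Archimedean2 by blast
  then have m: "C \<le> real (Suc m)" "1 / \<delta> \<le> real (Suc m)" by auto
  have "norm (a k) \<le> real (Suc m) ^ Suc (sum k UNIV)" for k
  proof -
    have "C \<ge> 0"
      using bound[of k] \<open>\<delta> > 0\<close> by (meson norm_ge_zero order_trans mult_nonneg_nonneg zero_le_power less_imp_le)
    have "norm (a k) \<le> C * (1 / \<delta>) ^ sum k UNIV"
      using bound[of k] \<open>\<delta> > 0\<close> by (simp add: field_simps power_divide)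
    also have "\<dots> \<le> real (Suc m) * real (Suc m) ^ sum k UNIV"
      using m \<open>\<delta> > 0\<close> \<open>C \<ge> 0\<close> by (intro mult_mono power_mono) auto
    finally show ?thesis by simp
  qed
  moreover have "(\<Sum>\<^sub>\<infinity>k. power_series_term a 0 s k) = f (torus_exp (\<theta> + s))"
    if s: "\<forall>i. \<bar>s $ i\<bar> \<le> 1 / (2 * real (Suc m))" for s
  proof -
    have "1 / (2 * real (Suc m)) \<le> \<delta>"
    proof -
      have "1 \<le> \<delta> * real (Suc m)"
        using m(2) \<open>\<delta> > 0\<close> by (simp add: divide_le_eq mult.commute)
      also have "\<dots> \<le> \<delta> * (2 * real (Suc m))"
        using \<open>\<delta> > 0\<close> by (intro mult_left_mono) auto
      finally show ?thesis
        by (subst divide_le_eq) auto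
    qed
    then have s': "\<bar>s $ i\<bar> \<le> \<delta>" for i
      using s order_trans by blast
    have "\<theta>' + s \<in> cbox (\<chi> i. \<theta>' $ i - \<delta>) (\<chi> i. \<theta>' $ i + \<delta>)"
      unfolding mem_box_cart using s' by (simp add: abs_le_iff) (smt (verit, best))
    from f[OF this] show ?thesis
      using torus_exp_eq_imp_shift[OF eq] by (simp add: power_series_term_def)
  qed
  ultimately show "\<exists>m a. power_series_bounded_by (Suc m) f \<theta> a"
    unfolding power_series_bounded_by_def by blast
next
  assume "\<exists>m a. power_series_bounded_by (Suc m) f \<theta> a"
  then obtain m a where a: "\<And>k. norm (a k) \<le> real (Suc m) ^ Suc (sum k UNIV)"
    and f: "\<And>s. (\<forall>i. \<bar>s $ i\<bar> \<le> 1 / (2 * real (Suc m))) \<Longrightarrow>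
        (\<Sum>\<^sub>\<infinity>k. power_series_term a 0 s k) = f (torus_exp (\<theta> + s))"
    unfolding power_series_bounded_by_def by blast
  define \<delta> where "\<delta> = 1 / (2 * real (Suc m))"
  define B where "B = cbox (\<chi> i. \<theta> $ i - \<delta>) (\<chi> i. \<theta> $ i + \<delta>)"
  have B: "\<bar>(t - \<theta>) $ i\<bar> \<le> \<delta>" if "t \<in> B" for t i
  proof -
    have "\<theta> $ i - \<delta> \<le> t $ i" "t $ i \<le> \<theta> $ i + \<delta>"
      using that unfolding B_def mem_box_cart by auto
    then show ?thesis by simp
  qed
  have shift: "power_series_term a \<theta> t = power_series_term a 0 (t - \<theta>)" for t
    by (simp add: power_series_term_def fun_eq_iff)
  have le: "norm (power_series_term a \<theta> t k) \<le> real (Suc m) * (1/2) ^ sum k UNIV" if "t \<in> B" for t k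
    unfolding shift using B[OF that] by (intro norm_power_series_term_le a) (auto simp: \<delta>_def)
  have "\<forall>t\<in>B. (\<lambda>k. norm (power_series_term a \<theta> t k)) summable_on UNIV"
    using le by (auto intro: Infinite_Sum.abs_summable_on_comparison_test'[OF summable_on_geometric_majorant[of "Suc m"]])
  moreover have "uniform_limit B (\<lambda>F t. \<Sum>k\<in>F. power_series_term a \<theta> t k)
      (\<lambda>t. \<Sum>\<^sub>\<infinity>k. power_series_term a \<theta> t k) (finite_subsets_at_top UNIV)"
    using le by (intro Weierstrass_m_test_general[OF _ summable_on_geometric_majorant[of "Suc m"]])
  moreover have "(\<Sum>\<^sub>\<infinity>k. power_series_term a \<theta> t k) = f (torus_exp t)" if "t \<in> B" for t
    unfolding shift using f[of "t - \<theta>"] B[OF that] by (simp add: \<delta>_def)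
  moreover have "\<delta> > 0" by (simp add: \<delta>_def)
  ultimately show "real_analytic_at_torus f (torus_exp \<theta>)"
    unfolding real_analytic_at_torus_def Let_def B_def by blast
qed

text \<open>
  The set is a product of closed discs, so Tychonoff's theorem applies.
\<close>

lemma compact_bounded_coefficients:
  fixes b :: "'k \<Rightarrow> real"
  shows "compact {a :: 'k \<Rightarrow> complex. \<forall>k. norm (a k) \<le> b k}"
proof -
  have "compactin (product_topology (\<lambda>_. euclidean) UNIV) (PiE UNIV (\<lambda>k. cball (0::complex) (b k)))"
    unfolding compactin_PiE by simp
  also have "PiE UNIV (\<lambda>k. cball (0::complex) (b k)) = {a. \<forall>k. norm (a k) \<le> b k}"
    by auto
  finally show ?thesis
    by (simp add: euclidean_product_topology)
qed

text \<open>
  Dominated convergence for sums over an arbitrary index set, by exchanging uniform limits.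
\<close>

lemma tendsto_infsum_dominated:
  fixes a :: "nat \<Rightarrow> 'k \<Rightarrow> 'b::banach"
  assumes lim: "\<And>k. (\<lambda>n. a n k) \<longlonglongrightarrow> b k"
    and le: "\<And>n k. norm (a n k) \<le> g k" and g: "g summable_on UNIV"
  shows "(\<lambda>n. \<Sum>\<^sub>\<infinity>k. a n k) \<longlonglongrightarrow> (\<Sum>\<^sub>\<infinity>k. b k)"
proof (rule swap_uniform_limit'[where S = UNIV and F = "finite_subsets_at_top UNIV"])
  have b: "norm (b k) \<le> g k" for k
    by (rule LIMSEQ_le_const2[OF tendsto_norm[OF lim]]) (use le in auto)
  have "(\<lambda>k. norm (b k)) summable_on UNIV"
    using b by (auto intro: Infinite_Sum.abs_summable_on_comparison_test'[OF g])
  then have "b summable_on UNIV"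
    by (rule abs_summable_summable)
  from has_sum_infsum[OF this] show "((\<lambda>F. sum b F) \<longlongrightarrow> (\<Sum>\<^sub>\<infinity>k. b k)) (finite_subsets_at_top UNIV)"
    by (simp add: has_sum_def)
  show "uniform_limit UNIV (\<lambda>F n. \<Sum>k\<in>F. a n k) (\<lambda>n. \<Sum>\<^sub>\<infinity>k. a n k) (finite_subsets_at_top UNIV)"
    using le by (intro Weierstrass_m_test_general[OF _ g])
  show "\<forall>\<^sub>F F in finite_subsets_at_top UNIV. (\<lambda>n. \<Sum>k\<in>F. a n k) \<longlonglongrightarrow> sum b F"
    by (intro always_eventually allI tendsto_sum lim)
qed auto

text \<open>
  Centres and coefficient families that satisfy the bound form a compact space, which is sequentially
  compact because there are only countably many multi-indices. Along a convergent subsequence the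
  series converge by domination and the values by uniform convergence and continuity of \<open>f\<close>.
\<close>

lemma power_series_bounded_by_limit:
  fixes f :: "complex ^ 'n::finite \<Rightarrow> complex"
  assumes "M > 0" "compact K" and cont: "continuous_on torus f"
    and rep: "\<And>n. \<exists>\<theta>\<in>K. \<exists>a. power_series_bounded_by M (F n) \<theta> a"
    and lim: "uniform_limit torus F f sequentially"
  shows "\<exists>\<theta>\<in>K. \<exists>a. power_series_bounded_by M f \<theta> a"
proof -
  define A where "A = {a :: ('n \<Rightarrow> nat) \<Rightarrow> complex. \<forall>k. norm (a k) \<le> real M ^ Suc (sum k UNIV)}"
  obtain \<theta> a where \<theta>: "\<And>n. \<theta> n \<in> K" and a: "\<And>n. power_series_bounded_by M (F n) (\<theta> n) (a n)"
    using rep by metis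
  have aA: "a n \<in> A" for n
    using a[of n] by (simp add: A_def power_series_bounded_by_def)
  have "compact (K \<times> A)"
    unfolding A_def by (intro compact_Times \<open>compact K\<close> compact_bounded_coefficients)
  then have "seq_compact (K \<times> A)"
    by (rule compact_imp_seq_compact)
  then obtain l \<sigma> where l: "l \<in> K \<times> A" and \<sigma>: "strict_mono (\<sigma> :: nat \<Rightarrow> nat)"
    and conv: "((\<lambda>n. (\<theta> n, a n)) \<circ> \<sigma>) \<longlonglongrightarrow> l"
    by (rule seq_compactE[where f = "\<lambda>n. (\<theta> n, a n)"]) (use \<theta> aA in auto)
  obtain \<theta>0 a0 where l_eq: "l = (\<theta>0, a0)" by (cases l)
  have \<theta>_lim: "(\<lambda>n. \<theta> (\<sigma> n)) \<longlonglongrightarrow> \<theta>0"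
    using tendsto_fst[OF conv] by (simp add: l_eq)
  have "(\<lambda>n. a (\<sigma> n)) \<longlonglongrightarrow> a0"
    using tendsto_snd[OF conv] by (simp add: l_eq)
  then have a_lim: "(\<lambda>n. a (\<sigma> n) k) \<longlonglongrightarrow> a0 k" for k
    by (rule continuous_on_tendsto_compose[OF continuous_on_product_coordinates]) auto
  have "(\<Sum>\<^sub>\<infinity>k. power_series_term a0 0 s k) = f (torus_exp (\<theta>0 + s))"
    if s: "\<forall>i. \<bar>s $ i\<bar> \<le> 1 / (2 * real M)" for s
  proof (rule LIMSEQ_unique)
    show "(\<lambda>n. \<Sum>\<^sub>\<infinity>k. power_series_term (a (\<sigma> n)) 0 s k) \<longlonglongrightarrow> (\<Sum>\<^sub>\<infinity>k. power_series_term a0 0 s k)"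
    proof (rule tendsto_infsum_dominated[OF _ _ summable_on_geometric_majorant])
      show "norm (power_series_term (a (\<sigma> n)) 0 s k) \<le> real M * (1/2) ^ sum k UNIV" for n k
        using aA s \<open>M > 0\<close> by (intro norm_power_series_term_le) (auto simp: A_def)
      show "(\<lambda>n. power_series_term (a (\<sigma> n)) 0 s k) \<longlonglongrightarrow> power_series_term a0 0 s k" for k
        unfolding power_series_term_def by (intro tendsto_intros a_lim)
    qed
    let ?z = "\<lambda>n. torus_exp (\<theta> (\<sigma> n) + s)"
    have z_lim: "?z \<longlonglongrightarrow> torus_exp (\<theta>0 + s)"
      unfolding torus_exp_def vector_add_component cis_conv_exp
      by (intro tendsto_vec_lambda tendsto_intros tendsto_vec_nth \<theta>_lim)
    have "(\<lambda>n. f (?z n)) \<longlonglongrightarrow> f (torus_exp (\<theta>0 + s))"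
      using continuous_on_tendsto_compose[OF cont z_lim] by simp
    moreover have "(\<lambda>n. F (\<sigma> n) (?z n) - f (?z n)) \<longlonglongrightarrow> 0"
    proof (rule tendstoI)
      fix e :: real assume "e > 0"
      from uniform_limitD[OF lim this]
      have "\<forall>\<^sub>F n in sequentially. \<forall>z\<in>torus. dist (F (\<sigma> n) z) (f z) < e"
        by (rule eventually_subseq[OF \<sigma>])
      then show "\<forall>\<^sub>F n in sequentially. dist (F (\<sigma> n) (?z n) - f (?z n)) 0 < e"
        by eventually_elim (simp add: dist_norm)
    qed
    ultimately have "(\<lambda>n. F (\<sigma> n) (?z n)) \<longlonglongrightarrow> f (torus_exp (\<theta>0 + s))"
      using tendsto_add by fastforce
    moreover have "F (\<sigma> n) (?z n) = (\<Sum>\<^sub>\<infinity>k. power_series_term (a (\<sigma> n)) 0 s k)" for n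
      using a[of "\<sigma> n"] s by (simp add: power_series_bounded_by_def)
    ultimately show "(\<lambda>n. \<Sum>\<^sub>\<infinity>k. power_series_term (a (\<sigma> n)) 0 s k) \<longlonglongrightarrow> f (torus_exp (\<theta>0 + s))"
      by simp
  qed
  then have "power_series_bounded_by M f \<theta>0 a0"
    using l by (simp add: l_eq A_def power_series_bounded_by_def)
  with l show ?thesis by (auto simp: l_eq)
qed

text \<open>
  Letting only the \<open>j\<close>-th coordinate become complex turns the power series into a uniformly convergent
  series of polynomials in one complex variable. The disc is centred at the \<open>j\<close>-th coordinate of an
  arbitrary interior point \<open>q\<close> of the box, so that series with different
  centres whose boxes share the point \<open>q\<close> yield functions on a common disc.
\<close>

lemma power_series_holomorphic_on_line:
  fixes f :: "complex ^ 'n::finite \<Rightarrow> complex"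
  assumes "M > 0" and rep: "power_series_bounded_by M f \<theta> a"
    and q: "\<And>i. \<bar>q $ i - \<theta> $ i\<bar> < 1 / (2 * real M)"
  obtains r H where "r > 0" "H holomorphic_on ball (of_real (q $ j)) r"
    "\<And>t. \<bar>t - q $ j\<bar> < r \<Longrightarrow> H (of_real t) = f (torus_exp (\<chi> i. if i = j then t else q $ i))"
proof -
  define r where "r = 1 / (2 * real M) - \<bar>q $ j - \<theta> $ j\<bar>"
  define w :: "complex \<Rightarrow> 'n \<Rightarrow> complex"
    where "w u i = (if i = j then u else of_real (q $ i)) - of_real (\<theta> $ i)" for u i
  define H where "H u = (\<Sum>\<^sub>\<infinity>k. a k * (\<Prod>i\<in>UNIV. w u i ^ k i))" for u
  have "r > 0" using q[of j] by (simp add: r_def)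
  have w_le: "norm (w u i) \<le> 1 / (2 * real M)" if "u \<in> cball (of_real (q $ j)) r" for u i
  proof (cases "i = j")
    case True
    have "norm (w u i) \<le> norm (u - of_real (q $ j)) + norm (complex_of_real (q $ j - \<theta> $ j))"
      unfolding w_def using True norm_triangle_ineq[of "u - of_real (q $ j)" "of_real (q $ j - \<theta> $ j)"] by simp
    also have "\<dots> \<le> r + \<bar>q $ j - \<theta> $ j\<bar>"
      using that by (simp add: dist_norm norm_minus_commute del: of_real_diff)
    finally show ?thesis by (simp add: r_def)
  next
    case False
    then show ?thesis
      using q[of i] by (simp add: w_def less_imp_le flip: of_real_diff)
  qed
  have "uniform_limit (cball (of_real (q $ j)) r) (\<lambda>F u. \<Sum>k\<in>F. a k * (\<Prod>i\<in>UNIV. w u i ^ k i)) H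
      (finite_subsets_at_top UNIV)"
    unfolding H_def
  proof (rule Weierstrass_m_test_general[OF _ summable_on_geometric_majorant])
    show "norm (a k * (\<Prod>i\<in>UNIV. w u i ^ k i)) \<le> real M * (1/2) ^ sum k UNIV"
      if "u \<in> cball (of_real (q $ j)) r" for k u
      unfolding norm_mult using rep w_le[OF that] \<open>M > 0\<close>
      by (intro geometric_majorant) (auto simp: power_series_bounded_by_def)
  qed
  moreover have hol_w: "(\<lambda>u. w u i) holomorphic_on S" for i S
    unfolding w_def by (cases "i = j") (auto intro!: holomorphic_intros)
  have hol: "(\<lambda>u. \<Sum>k\<in>F. a k * (\<Prod>i\<in>UNIV. w u i ^ k i)) holomorphic_on S" for F S
    by (intro holomorphic_intros hol_w)
  ultimately have "H holomorphic_on ball (of_real (q $ j)) r"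
    using holomorphic_on_imp_continuous_on[OF hol]
    by (elim holomorphic_uniform_limit[rotated]) (auto intro!: always_eventually hol)
  moreover have "H (of_real t) = f (torus_exp (\<chi> i. if i = j then t else q $ i))"
    if t: "\<bar>t - q $ j\<bar> < r" for t
  proof -
    define s where "s = (\<chi> i. if i = j then t else q $ i) - \<theta>"
    have ws: "w (of_real t) i = of_real (s $ i)" for i
      by (simp add: w_def s_def)
    have "\<bar>s $ i\<bar> \<le> 1 / (2 * real M)" for i
      using w_le[of "of_real t" i] t unfolding ws by (simp add: dist_of_real dist_real_def abs_minus_commute)
    then have "(\<Sum>\<^sub>\<infinity>k. power_series_term a 0 s k) = f (torus_exp (\<theta> + s))"
      using rep by (simp add: power_series_bounded_by_def)
    then show ?thesis
      by (simp add: H_def ws power_series_term_def s_def)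
  qed
  ultimately show thesis
    using that[OF \<open>r > 0\<close>] by blast
qed

section \<open>Derivatives on the torus and the topology of the function space\<close>

lemma torus_eq_image_box:
  "(torus :: (complex ^ 'n) set) = torus_exp ` cbox (\<chi> i::'n::finite. - pi) (\<chi> i. pi)"
proof (intro equalityI subsetI)
  fix z :: "complex ^ 'n" assume z: "z \<in> torus"
  then have "cis (Arg (z $ i)) = z $ i" for i
    using rcis_cmod_Arg[of "z $ i"] by (simp add: torus_def rcis_def)
  then have "z = torus_exp (\<chi> i. Arg (z $ i))"
    by (simp add: torus_exp_def vec_eq_iff)
  moreover have "(\<chi> i. Arg (z $ i)) \<in> cbox (\<chi> i::'n. - pi) (\<chi> i. pi)"
    unfolding mem_box_cart using Arg_bounded by (auto simp: less_imp_le)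
  ultimately show "z \<in> torus_exp ` cbox (\<chi> i::'n. - pi) (\<chi> i. pi)"
    by blast
qed auto

lemma compact_torus: "compact (torus :: (complex ^ 'n::finite) set)"
  unfolding torus_eq_image_box torus_exp_def cis_conv_exp
  by (intro compact_continuous_image continuous_intros compact_cbox)

lemma rotate_coord_in_torus: "z \<in> torus \<Longrightarrow> rotate_coord j t z \<in> torus"
  by (simp add: torus_def rotate_coord_def norm_mult)

lemma rotate_coord_nth: "rotate_coord i t z $ j = (if i = j then cis t * z $ j else z $ j)"
  by (auto simp: rotate_coord_def)

lemma has_angle_deriv:
  assumes "angle_differentiable j f z"
  shows "((\<lambda>t. f (rotate_coord j t z)) has_vector_derivative angle_deriv j f z) (at 0)"
  using assms vector_derivative_works unfolding angle_differentiable_def angle_deriv_def by blast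

lemma angle_derivI:
  assumes "((\<lambda>t. f (rotate_coord j t z)) has_vector_derivative D) (at 0)"
  shows "angle_differentiable j f z" "angle_deriv j f z = D"
  using assms unfolding angle_differentiable_def angle_deriv_def
  by (auto intro: differentiableI_vector vector_derivative_at)

lemma angle_deriv_cong:
  assumes "\<And>w. w \<in> torus \<Longrightarrow> f w = g w" "z \<in> torus"
  shows "angle_differentiable j f z \<longleftrightarrow> angle_differentiable j g z"
    and "angle_deriv j f z = angle_deriv j g z"
proof -
  have "(\<lambda>t. f (rotate_coord j t z)) = (\<lambda>t. g (rotate_coord j t z))"
    using assms rotate_coord_in_torus by blast
  then show "angle_differentiable j f z \<longleftrightarrow> angle_differentiable j g z"
    and "angle_deriv j f z = angle_deriv j g z"
    by (simp_all add: angle_differentiable_def angle_deriv_def)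
qed

lemma angle_derivs_cong:
  assumes "\<And>w. w \<in> torus \<Longrightarrow> f w = g w"
  shows "has_angle_derivs js f \<longleftrightarrow> has_angle_derivs js g"
    and "z \<in> torus \<Longrightarrow> angle_derivs js f z = angle_derivs js g z"
proof -
  have *: "(has_angle_derivs js f \<longleftrightarrow> has_angle_derivs js g) \<and>
      (\<forall>z\<in>torus. angle_derivs js f z = angle_derivs js g z)"
  proof (induction js)
    case Nil
    then show ?case using assms by simp
  next
    case (Cons j js)
    then show ?case
      using angle_deriv_cong[of "angle_derivs js f" "angle_derivs js g"] by simp
  qed
  show "has_angle_derivs js f \<longleftrightarrow> has_angle_derivs js g" using * by blast
  show "z \<in> torus \<Longrightarrow> angle_derivs js f z = angle_derivs js g z" using * by blast
qed

text \<open>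
  Linearity is expressed by a single combination, with addition and subtraction as special cases;
  existence of the derivatives is proved along with the formula, since each step of the induction
  needs it.
\<close>

lemma angle_derivs_add_cmult:
  assumes "has_angle_derivs js f" "has_angle_derivs js g"
  shows "has_angle_derivs js (\<lambda>z. f z + c * g z) \<and>
    (\<forall>z\<in>torus. angle_derivs js (\<lambda>z. f z + c * g z) z = angle_derivs js f z + c * angle_derivs js g z)"
  using assms
proof (induction js)
  case Nil
  then show ?case by simp
next
  case (Cons j js)
  let ?h = "angle_derivs js (\<lambda>z. f z + c * g z)"
  have IH: "has_angle_derivs js (\<lambda>z. f z + c * g z)"
    "\<And>z. z \<in> torus \<Longrightarrow> ?h z = angle_derivs js f z + c * angle_derivs js g z"
    using Cons by auto
  have "((\<lambda>t. ?h (rotate_coord j t z)) has_vector_derivative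
      angle_deriv j (angle_derivs js f) z + c * angle_deriv j (angle_derivs js g) z) (at 0)"
    if z: "z \<in> torus" for z
  proof -
    have "angle_differentiable j (angle_derivs js f) z" "angle_differentiable j (angle_derivs js g) z"
      using Cons.prems z by auto
    then show ?thesis
      unfolding IH(2)[OF rotate_coord_in_torus[OF z]]
      by (intro has_vector_derivative_add has_vector_derivative_mult_right has_angle_deriv)
  qed
  from angle_derivI[OF this] IH(1) show ?case
    by simp
qed

lemma directions_0: "directions (\<lambda>_. 0) = []"
  by (simp add: directions_def)

lemma zero_in_multi_indices: "(\<lambda>_. 0) \<in> multi_indices p"
  by (simp add: multi_indices_def zero_enat_def [symmetric])

lemma Cp_imp_continuous_on: "f \<in> Cp p \<Longrightarrow> continuous_on torus f"
  using zero_in_multi_indices by (fastforce simp: Cp_def directions_0)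

lemma Cp_add_cmult:
  assumes "f \<in> Cp p" "g \<in> Cp p"
  shows "restrict (\<lambda>z. f z + c * g z) torus \<in> Cp p"
  unfolding Cp_def
proof (intro CollectI conjI ballI)
  fix \<alpha> :: "'a \<Rightarrow> nat" assume \<alpha>: "\<alpha> \<in> multi_indices p"
  let ?h = "restrict (\<lambda>z. f z + c * g z) torus"
  have f: "has_multi_deriv \<alpha> f" "continuous_on torus (multi_deriv \<alpha> f)"
    and g: "has_multi_deriv \<alpha> g" "continuous_on torus (multi_deriv \<alpha> g)"
    using assms \<alpha> by (auto simp: Cp_def)
  note lin = angle_derivs_add_cmult[OF f(1) g(1), of c]
  note cong = angle_derivs_cong[where f = ?h and g = "\<lambda>z. f z + c * g z" and js = "directions \<alpha>"]
  show "has_multi_deriv \<alpha> ?h"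
    using lin cong(1) by simp
  have "continuous_on torus (\<lambda>z. multi_deriv \<alpha> f z + c * multi_deriv \<alpha> g z)"
    by (intro continuous_intros f g)
  then show "continuous_on torus (multi_deriv \<alpha> ?h)"
    by (rule continuous_on_eq) (use lin cong(2) in simp)
qed simp

lemma Cp_seminorm_upper:
  assumes "continuous_on torus (multi_deriv \<alpha> f)" "z \<in> torus"
  shows "cmod (multi_deriv \<alpha> f z) \<le> Cp_seminorm \<alpha> f"
proof -
  obtain \<theta> where z: "z = torus_exp \<theta>"
    using assms(2) range_torus_exp by blast
  have "bounded (multi_deriv \<alpha> f ` torus)"
    by (intro compact_imp_bounded compact_continuous_image assms compact_torus)
  then obtain B where "\<And>w. w \<in> torus \<Longrightarrow> cmod (multi_deriv \<alpha> f w) \<le> B"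
    unfolding bounded_iff by blast
  then have "bdd_above (range (\<lambda>\<theta>. cmod (multi_deriv \<alpha> f (torus_exp \<theta>))))"
    by (intro bdd_aboveI[of _ B]) auto
  then show ?thesis
    unfolding Cp_seminorm_def z by (intro cSUP_upper) auto
qed

lemma Cp_seminorm_least:
  assumes "\<And>z. z \<in> torus \<Longrightarrow> cmod (multi_deriv \<alpha> f z) \<le> B"
  shows "Cp_seminorm \<alpha> f \<le> B"
  unfolding Cp_seminorm_def by (rule cSUP_least) (auto intro: assms)

lemma openin_Cp_seminorm_ball:
  assumes "f \<in> Cp p" "\<alpha> \<in> multi_indices p" "\<epsilon> > 0"
  shows "openin (Cp_topology p) {g \<in> Cp p. Cp_seminorm \<alpha> (\<lambda>z. g z - f z) < \<epsilon>}"
  unfolding Cp_topology_def by (rule topology_generated_by_Basis) (use assms in blast)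

text \<open>
  Each seminorm of \<open>f + c g - u\<close> is a Lipschitz function of \<open>c\<close> with constant the seminorm of \<open>g\<close>, and it
  suffices to look at preimages of the generating sets.
\<close>

lemma continuous_map_Cp_line:
  fixes f g :: "complex ^ 'n::{finite,linorder} \<Rightarrow> complex"
  assumes f: "f \<in> Cp p" and g: "g \<in> Cp p"
  shows "continuous_map euclideanreal (Cp_topology p) (\<lambda>c. restrict (\<lambda>z. f z + of_real c * g z) torus)"
    (is "continuous_map _ _ ?L")
  unfolding Cp_topology_def
proof (rule continuous_on_generated_topo)
  fix U :: "(complex ^ 'n::{finite,linorder} \<Rightarrow> complex) set"
  assume "U \<in> {{h \<in> Cp p. Cp_seminorm \<alpha> (\<lambda>z. h z - u z) < \<epsilon>} | u \<alpha> \<epsilon>.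
      u \<in> Cp p \<and> \<alpha> \<in> multi_indices p \<and> \<epsilon> > 0}"
  then obtain u \<alpha> \<epsilon> where U: "U = {h \<in> Cp p. Cp_seminorm \<alpha> (\<lambda>z. h z - u z) < \<epsilon>}"
    and u: "u \<in> Cp p" and \<alpha>: "\<alpha> \<in> multi_indices p" and "\<epsilon> > 0"
    by blast
  define N where "N c = Cp_seminorm \<alpha> (\<lambda>z. ?L c z - u z)" for c
  have D: "has_multi_deriv \<alpha> h" "continuous_on torus (multi_deriv \<alpha> h)" if "h \<in> Cp p" for h
    using that \<alpha> by (auto simp: Cp_def)
  have deriv_N: "multi_deriv \<alpha> (\<lambda>z. ?L c z - u z) z
      = multi_deriv \<alpha> f z + of_real c * multi_deriv \<alpha> g z - multi_deriv \<alpha> u z"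
    if "z \<in> torus" for c z
  proof -
    note 1 = angle_derivs_add_cmult[OF D(1)[OF f] D(1)[OF g], of "of_real c"]
    note 2 = angle_derivs_add_cmult[OF conjunct1[OF 1] D(1)[OF u], of "- 1"]
    have "multi_deriv \<alpha> (\<lambda>z. ?L c z - u z) z
        = multi_deriv \<alpha> (\<lambda>z. (f z + of_real c * g z) + (- 1) * u z) z"
      by (rule angle_derivs_cong(2)[OF _ that]) simp
    then show ?thesis
      using 1 2 that by simp
  qed
  have cont_N: "continuous_on torus (multi_deriv \<alpha> (\<lambda>z. ?L c z - u z))" for c
  proof (rule continuous_on_eq)
    show "continuous_on torus (\<lambda>z. multi_deriv \<alpha> f z + of_real c * multi_deriv \<alpha> g z - multi_deriv \<alpha> u z)"
      by (intro continuous_intros D f g u)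
  qed (simp only: deriv_N)
  define G where "G = Cp_seminorm \<alpha> g"
  have N_le: "N c' \<le> N c + \<bar>c' - c\<bar> * G" for c c'
    unfolding N_def
  proof (rule Cp_seminorm_least)
    fix z :: "complex ^ 'n::{finite,linorder}" assume z: "z \<in> torus"
    have "multi_deriv \<alpha> (\<lambda>z. ?L c' z - u z) z
        = multi_deriv \<alpha> (\<lambda>z. ?L c z - u z) z + of_real (c' - c) * multi_deriv \<alpha> g z"
      unfolding deriv_N[OF z] by (simp add: algebra_simps)
    also have "cmod \<dots> \<le> cmod (multi_deriv \<alpha> (\<lambda>z. ?L c z - u z) z) + \<bar>c' - c\<bar> * cmod (multi_deriv \<alpha> g z)"
      by (rule order_trans[OF norm_triangle_ineq]) (simp only: norm_mult norm_of_real order_refl)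
    also have "\<dots> \<le> Cp_seminorm \<alpha> (\<lambda>z. ?L c z - u z) + \<bar>c' - c\<bar> * G"
      unfolding G_def by (intro add_mono mult_left_mono Cp_seminorm_upper cont_N D g z) auto
    finally show "cmod (multi_deriv \<alpha> (\<lambda>z. ?L c' z - u z) z)
        \<le> Cp_seminorm \<alpha> (\<lambda>z. ?L c z - u z) + \<bar>c' - c\<bar> * G" .
  qed
  have "G \<ge> 0"
    using Cp_seminorm_upper[OF D(2)[OF g] torus_exp_in_torus[of 0]] norm_ge_zero
    unfolding G_def by (rule order_trans[rotated])
  have "open {c. N c < \<epsilon>}"
    unfolding open_dist
  proof (intro ballI)
    fix c assume "c \<in> {c. N c < \<epsilon>}"
    then have "0 < (\<epsilon> - N c) / (G + 1)"
      using \<open>G \<ge> 0\<close> by simp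
    moreover have "N c' < \<epsilon>" if "dist c' c < (\<epsilon> - N c) / (G + 1)" for c'
    proof -
      have "\<bar>c' - c\<bar> * (G + 1) < \<epsilon> - N c"
        using that \<open>G \<ge> 0\<close> by (simp add: dist_real_def pos_less_divide_eq)
      moreover have "\<bar>c' - c\<bar> * G \<le> \<bar>c' - c\<bar> * (G + 1)"
        by (intro mult_left_mono) auto
      ultimately show ?thesis
        using N_le[of c' c] by linarith
    qed
    ultimately show "\<exists>e>0. \<forall>c'. dist c' c < e \<longrightarrow> c' \<in> {c. N c < \<epsilon>}"
      by blast
  qed
  moreover have "?L -` U \<inter> topspace euclideanreal = {c. N c < \<epsilon>}"
    unfolding U N_def using Cp_add_cmult[OF f g] by auto
  ultimately show "openin euclideanreal (?L -` U \<inter> topspace euclideanreal)"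
    by simp
next
  have "?L ` topspace euclideanreal \<subseteq> topspace (Cp_topology p)"
    using Cp_add_cmult[OF f g] by auto
  then show "?L ` topspace euclideanreal \<subseteq> \<Union> {{h \<in> Cp p. Cp_seminorm \<alpha> (\<lambda>z. h z - u z) < \<epsilon>} | u \<alpha> \<epsilon>.
      u \<in> Cp p \<and> \<alpha> \<in> multi_indices p \<and> \<epsilon> > 0}"
    unfolding Cp_topology_def topology_generated_by_topspace .
qed

section \<open>The analytic functions form a countable union of closed sets\<close>

text \<open>
  The seminorm of order zero is the supremum norm. If no ball for this seminorm around \<open>f\<close> missed
  the set, then \<open>f\<close> would be a uniform limit of its elements.
\<close>

lemma closedin_power_series_bounded_by:
  fixes K :: "(real ^ 'n::{finite,linorder}) set"
  assumes "M > 0" "compact K"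
  shows "closedin (Cp_topology p) {f \<in> Cp p. \<exists>\<theta>\<in>K. \<exists>a. power_series_bounded_by M f \<theta> a}"
    (is "closedin _ ?E")
  unfolding closedin_def
proof (intro conjI)
  show "openin (Cp_topology p) (topspace (Cp_topology p) - ?E)"
  proof (subst openin_subopen, intro ballI)
    fix f :: "complex ^ 'n::{finite,linorder} \<Rightarrow> complex" assume f: "f \<in> topspace (Cp_topology p) - ?E"
    define V where "V \<epsilon> = {g \<in> Cp p. Cp_seminorm (\<lambda>_. 0) (\<lambda>z. g z - f z) < \<epsilon>}" for \<epsilon>
    have dist_less: "dist (g z) (f z) < \<epsilon>" if g: "g \<in> V \<epsilon>" and z: "z \<in> torus" for g z \<epsilon>
    proof -
      have "continuous_on torus (multi_deriv (\<lambda>_. 0) (\<lambda>z. g z - f z))"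
        using f g Cp_imp_continuous_on[of f p] Cp_imp_continuous_on[of g p]
        by (simp add: V_def directions_0 continuous_on_diff)
      from Cp_seminorm_upper[OF this z] show ?thesis
        using g by (simp add: V_def directions_0 dist_norm)
    qed
    have "\<exists>\<epsilon>>0. V \<epsilon> \<inter> ?E = {}"
    proof (rule ccontr)
      assume none: "\<not> ?thesis"
      have "\<exists>g. g \<in> V (1 / real (Suc n)) \<inter> ?E" for n
      proof -
        have "1 / real (Suc n) > 0" by simp
        with none show ?thesis by blast
      qed
      then have "\<exists>F. \<forall>n. F n \<in> V (1 / real (Suc n)) \<inter> ?E"
        by (intro choice allI)
      then obtain F where F: "\<And>n. F n \<in> V (1 / real (Suc n)) \<inter> ?E"
        by blast
      have lim: "uniform_limit torus F f sequentially"
      proof (rule uniform_limitI)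
        fix e :: real assume "e > 0"
        have "\<forall>\<^sub>F n in sequentially. 1 / real (Suc n) < e"
          by (rule order_tendstoD(2)[OF LIMSEQ_Suc[OF lim_inverse_n'] \<open>e > 0\<close>])
        then show "\<forall>\<^sub>F n in sequentially. \<forall>z\<in>torus. dist (F n z) (f z) < e"
        proof eventually_elim
          case (elim n)
          have "F n \<in> V (1 / real (Suc n))" using F by blast
          with elim show ?case
            by (intro ballI) (rule order.strict_trans[OF dist_less])
        qed
      qed
      have cont: "continuous_on torus f"
        using f by (intro Cp_imp_continuous_on[of f p]) simp
      have "\<exists>\<theta>\<in>K. \<exists>a. power_series_bounded_by M (F n) \<theta> a" for n
        using F[of n] by blast
      then have "\<exists>\<theta>\<in>K. \<exists>a. power_series_bounded_by M f \<theta> a"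
        by (rule power_series_bounded_by_limit[OF assms cont _ lim])
      with f show False by simp
    qed
    then obtain \<epsilon> where "\<epsilon> > 0" "V \<epsilon> \<inter> ?E = {}" by blast
    moreover have "openin (Cp_topology p) (V \<epsilon>)"
      unfolding V_def using f \<open>\<epsilon> > 0\<close> by (intro openin_Cp_seminorm_ball zero_in_multi_indices) auto
    moreover have "f \<in> V \<epsilon>"
      using f \<open>\<epsilon> > 0\<close> by (simp add: V_def Cp_seminorm_def directions_0)
    moreover have "V \<epsilon> \<subseteq> topspace (Cp_topology p)"
      by (auto simp: V_def)
    ultimately show "\<exists>T. openin (Cp_topology p) T \<and> f \<in> T \<and> T \<subseteq> topspace (Cp_topology p) - ?E"
      by blast
  qed
qed auto

text \<open>
  The complement is the union over \<open>m\<close> of the closed sets for the bounds \<open>M = m + 1\<close>. The compact set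
  \<open>K\<close> allows a single point and the whole torus to be treated alike.
\<close>

lemma gdelta_in_nowhere_analytic:
  fixes K :: "(real ^ 'n::{finite,linorder}) set"
  assumes "compact K"
  shows "gdelta_in (Cp_topology p) {f \<in> Cp p. \<forall>\<theta>\<in>K. \<not> real_analytic_at_torus f (torus_exp \<theta>)}"
proof -
  have "topspace (Cp_topology p) - {f \<in> Cp p. \<forall>\<theta>\<in>K. \<not> real_analytic_at_torus f (torus_exp \<theta>)}
      = (\<Union>m. {f \<in> Cp p. \<exists>\<theta>\<in>K. \<exists>a. power_series_bounded_by (Suc m) f \<theta> a})"
    by (auto simp: real_analytic_at_torus_iff_bounded)
  moreover have "fsigma_in (Cp_topology p) \<dots>"
    by (rule fsigma_in_Union)
       (auto intro!: closed_imp_fsigma_in closedin_power_series_bounded_by assms)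
  ultimately show ?thesis
    by (auto simp: gdelta_in_fsigma_in)
qed

section \<open>Density of the nowhere analytic functions\<close>

text \<open>
  Differentiating in the direction \<open>j\<close> raises the order of the lacunary series, and any other direction
  gives zero, so the mixed derivatives of the series are again lacunary series or vanish.
\<close>

lemma angle_derivs_lacunary:
  "has_angle_derivs js (\<lambda>z. lacunary 0 (z $ j)) \<and>
   (\<forall>z\<in>torus. angle_derivs js (\<lambda>z. lacunary 0 (z $ j)) z =
      (if set js \<subseteq> {j} then lacunary (length js) (z $ j) else 0))"
proof (induction js)
  case Nil
  then show ?case by simp
next
  case (Cons i js)
  let ?F = "angle_derivs js (\<lambda>z. lacunary 0 (z $ j))"
  let ?D = "\<lambda>z. if set (i # js) \<subseteq> {j} then lacunary (length (i # js)) (z $ j) else 0"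
  have F: "?F w = (if set js \<subseteq> {j} then lacunary (length js) (w $ j) else 0)" if "w \<in> torus" for w
    using Cons that by blast
  have "((\<lambda>t. ?F (rotate_coord i t z)) has_vector_derivative ?D z) (at 0)" if z: "z \<in> torus" for z
  proof (cases "set (i # js) \<subseteq> {j}")
    case True
    have "cmod (z $ j) = 1" using z by (simp add: torus_def)
    then obtain x where x: "z $ j = cis x"
      using rcis_cmod_Arg[of "z $ j"] that[of "Arg (z $ j)"] by (simp add: rcis_def)
    have "((\<lambda>t. lacunary (length js) (cis t)) \<circ> (\<lambda>t. t + x) has_vector_derivative
        1 *\<^sub>R lacunary (Suc (length js)) (cis (0 + x))) (at 0)"
      by (intro vector_diff_chain_at lacunary_has_vector_derivative) (auto intro!: derivative_eq_intros)
    then show ?thesis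
      using True by (simp add: F[OF rotate_coord_in_torus[OF z]] rotate_coord_nth x cis_mult o_def)
  next
    case False
    then have "(\<lambda>t. ?F (rotate_coord i t z)) = (\<lambda>_. ?F z)"
      by (auto simp: F[OF rotate_coord_in_torus[OF z]] F[OF z] rotate_coord_nth)
    with False show ?thesis by auto
  qed
  from angle_derivI[OF this] Cons show ?case
    by simp
qed

lemma lacunary_in_Cp:
  "restrict (\<lambda>z. lacunary 0 (z $ j)) torus \<in> Cp p"
  unfolding Cp_def
proof (intro CollectI conjI ballI)
  fix \<alpha> :: "'a \<Rightarrow> nat"
  let ?g = "\<lambda>z :: complex ^ 'a::{finite,linorder}. lacunary 0 (z $ j)"
  note cong = angle_derivs_cong[where f = "restrict ?g torus" and g = ?g and js = "directions \<alpha>"]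
  note der = angle_derivs_lacunary[of "directions \<alpha>" j]
  show "has_multi_deriv \<alpha> (restrict ?g torus)"
    using cong(1) der by simp
  have "continuous_on torus (\<lambda>z :: complex ^ 'a::{finite,linorder}. lacunary m (z $ j))" for m
    by (rule continuous_on_compose2[OF continuous_on_lacunary])
       (auto intro!: continuous_intros simp: torus_def)
  then have "continuous_on torus (\<lambda>z :: complex ^ 'a::{finite,linorder}.
      if set (directions \<alpha>) \<subseteq> {j} then lacunary (length (directions \<alpha>)) (z $ j) else 0)"
    by (cases "set (directions \<alpha>) \<subseteq> {j}") simp_all
  then show "continuous_on torus (multi_deriv \<alpha> (restrict ?g torus))"
    by (rule continuous_on_eq) (use cong(2) der in simp)
qed simp

text \<open>
  On the segment \<open>f + c g\<close> only countably many \<open>c\<close> can give a function that is analytic somewhere: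
  two such parameters attached to the same point \<open>q\<close> of a countable dense set would make \<open>g\<close>
  holomorphic near \<open>q\<close> in its \<open>j\<close>-th angle.
\<close>

lemma dense_nowhere_analytic:
  fixes U :: "(complex ^ 'n::{finite,linorder} \<Rightarrow> complex) set"
  assumes "openin (Cp_topology p) U" "f \<in> U"
  shows "\<exists>h\<in>U. \<forall>\<zeta>\<in>torus. \<not> real_analytic_at_torus h \<zeta>"
proof (rule ccontr)
  assume analytic: "\<not> ?thesis"
  obtain j :: 'n where True by blast
  define g :: "complex ^ 'n::{finite,linorder} \<Rightarrow> complex" where "g = restrict (\<lambda>z. lacunary 0 (z $ j)) torus"
  define L where "L c = restrict (\<lambda>z. f z + of_real c * g z) torus" for c :: real
  have f: "f \<in> Cp p"
    using openin_subset[OF assms(1)] assms(2) by auto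
  have g: "g \<in> Cp p"
    unfolding g_def by (rule lacunary_in_Cp)
  have "open {c. L c \<in> U}"
    using openin_continuous_map_preimage[OF continuous_map_Cp_line[OF f g] assms(1)]
    by (simp add: L_def)
  moreover have "L 0 = f"
    using f by (auto simp: L_def Cp_def extensional_restrict)
  ultimately obtain e where "e > 0" and e: "ball 0 e \<subseteq> {c. L c \<in> U}"
    using assms(2) by (auto elim: openE[of _ 0])
  have L_analytic: "\<exists>\<theta> m a. power_series_bounded_by (Suc m) (L c) \<theta> a" if "c \<in> {0<..<e}" for c
  proof -
    have "L c \<in> U" using that e by (auto simp: subset_iff)
    with analytic obtain \<zeta> where "\<zeta> \<in> torus" "real_analytic_at_torus (L c) \<zeta>" by blast
    then show ?thesis
      unfolding range_torus_exp [symmetric] by (auto simp: real_analytic_at_torus_iff_bounded)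
  qed
  then obtain \<theta> m a where
    rep: "\<And>c. c \<in> {0<..<e} \<Longrightarrow> power_series_bounded_by (Suc (m c)) (L c) (\<theta> c) (a c)"
    by metis
  obtain D :: "(real ^ 'n::{finite,linorder}) set" where "countable D"
    and D: "\<And>X. open X \<Longrightarrow> X \<noteq> {} \<Longrightarrow> \<exists>q\<in>D. q \<in> X"
    by (rule countable_dense_setE) (rule that, assumption, blast)
  have "\<exists>q\<in>D. \<forall>i. \<bar>q $ i - \<theta> c $ i\<bar> < 1 / (2 * real (Suc (m c)))" for c
  proof -
    let ?B = "ball (\<theta> c) (1 / (2 * real (Suc (m c))))"
    obtain q where "q \<in> D" "q \<in> ?B"
      using D[of ?B] by auto
    moreover have "\<bar>q $ i - \<theta> c $ i\<bar> \<le> dist (\<theta> c) q" for i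
      using component_le_norm_cart[of "q - \<theta> c" i] by (simp add: dist_norm norm_minus_commute)
    ultimately show ?thesis
      by (intro bexI[of _ q]) (auto intro: le_less_trans)
  qed
  then obtain q where q: "\<And>c. q c \<in> D"
    and q_near: "\<And>c i. \<bar>q c $ i - \<theta> c $ i\<bar> < 1 / (2 * real (Suc (m c)))"
    by metis
  \<comment> \<open>An interval is uncountable, so two parameters share their point of the dense set.\<close>
  have "\<not> inj_on q {0<..<e}"
  proof
    assume "inj_on q {0<..<e}"
    moreover have "countable (q ` {0<..<e})"
      by (rule countable_subset[OF _ \<open>countable D\<close>]) (use q in auto)
    ultimately have "countable {0<..<e}"
      by (rule countable_image_inj_on[rotated])
    then show False
      using uncountable_open_interval[of 0 e] \<open>e > 0\<close> by simp
  qed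
  then obtain c c' where c: "c \<in> {0<..<e}" "c' \<in> {0<..<e}" "c \<noteq> c'" and q_eq: "q c' = q c"
    unfolding inj_on_def by metis
  let ?x = "q c $ j"
  let ?P = "\<lambda>t. torus_exp (\<chi> i. if i = j then t else q c $ i)"
  obtain r H where H: "r > 0" "H holomorphic_on ball (of_real ?x) r"
      "\<And>t. \<bar>t - ?x\<bar> < r \<Longrightarrow> H (of_real t) = L c (?P t)"
    using power_series_holomorphic_on_line[OF _ rep[OF c(1)] q_near, of j] by auto
  obtain r' H' where H': "r' > 0" "H' holomorphic_on ball (of_real ?x) r'"
      "\<And>t. \<bar>t - ?x\<bar> < r' \<Longrightarrow> H' (of_real t) = L c' (?P t)"
    using power_series_holomorphic_on_line[OF _ rep[OF c(2)] q_near, of j] unfolding q_eq by auto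
  show False
  proof (rule lacunary_no_holomorphic_extension)
    show "min r r' > 0" using H(1) H'(1) by simp
    have "H holomorphic_on ball (of_real ?x) (min r r')"
      by (rule holomorphic_on_subset[OF H(2)]) auto
    moreover have "H' holomorphic_on ball (of_real ?x) (min r r')"
      by (rule holomorphic_on_subset[OF H'(2)]) auto
    ultimately show "(\<lambda>u. (H u - H' u) / of_real (c - c')) holomorphic_on ball (of_real ?x) (min r r')"
      using c(3) by (intro holomorphic_intros) auto
    fix t assume t: "\<bar>t - ?x\<bar> < min r r'"
    \<comment> \<open>The two functions differ by a multiple of \<open>g\<close>, as the unknown \<open>f\<close> cancels.\<close>
    have "H (of_real t) - H' (of_real t) = of_real (c - c') * g (?P t)"
      using t H(3)[of t] H'(3)[of t] by (simp add: L_def algebra_simps)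
    also have "g (?P t) = lacunary 0 (cis t)"
      unfolding g_def restrict_apply'[OF torus_exp_in_torus] by (simp add: torus_exp_def)
    finally show "(H (of_real t) - H' (of_real t)) / of_real (c - c') = lacunary 0 (cis t)"
      using c(3) by (simp del: of_real_diff)
  qed
qed

theorem theorem13:
  fixes p :: enat
  shows "(\<forall>\<zeta>\<in>(torus :: (complex ^ 'n::{finite,linorder}) set).
            dense_Gdelta_in (Cp_topology p) {f \<in> Cp p. \<not> real_analytic_at_torus f \<zeta>}) \<and>
         dense_Gdelta_in (Cp_topology p)
            {f :: complex ^ 'n::{finite,linorder} \<Rightarrow> complex. f \<in> Cp p \<and> (\<forall>\<zeta>\<in>torus. \<not> real_analytic_at_torus f \<zeta>)}"
proof (intro conjI ballI)
  have dense: "Cp_topology p closure_of S = topspace (Cp_topology p)"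
    if "{f \<in> Cp p. \<forall>\<zeta>\<in>torus. \<not> real_analytic_at_torus f \<zeta>} \<subseteq> S"
    for S :: "(complex ^ 'n::{finite,linorder} \<Rightarrow> complex) set"
    unfolding dense_intersects_open
  proof (intro allI impI)
    fix U :: "(complex ^ 'n::{finite,linorder} \<Rightarrow> complex) set"
    assume U: "openin (Cp_topology p) U \<and> U \<noteq> {}"
    then obtain h where "h \<in> U" "\<forall>\<zeta>\<in>torus. \<not> real_analytic_at_torus h \<zeta>"
      using dense_nowhere_analytic by blast
    moreover from this U have "h \<in> Cp p"
      using openin_subset[of "Cp_topology p" U] by auto
    ultimately show "S \<inter> U \<noteq> {}"
      using that by blast
  qed
  show "dense_Gdelta_in (Cp_topology p) {f \<in> Cp p. \<not> real_analytic_at_torus f \<zeta>}"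
    if \<zeta>: "\<zeta> \<in> torus" for \<zeta> :: "complex ^ 'n::{finite,linorder}"
  proof -
    obtain \<theta> where "\<zeta> = torus_exp \<theta>"
      using \<zeta> range_torus_exp by blast
    then show ?thesis
      unfolding dense_Gdelta_in_def using gdelta_in_nowhere_analytic[of "{\<theta>}" p] \<zeta>
      by (intro conjI dense) auto
  qed
  have "{f \<in> Cp p. \<forall>\<zeta>\<in>torus. \<not> real_analytic_at_torus f \<zeta>} =
      {f \<in> Cp p. \<forall>\<theta>\<in>cbox (\<chi> i::'n. - pi) (\<chi> i. pi). \<not> real_analytic_at_torus f (torus_exp \<theta>)}"
    unfolding torus_eq_image_box by blast
  then show "dense_Gdelta_in (Cp_topology p)
      {f :: complex ^ 'n::{finite,linorder} \<Rightarrow> complex. f \<in> Cp p \<and> (\<forall>\<zeta>\<in>torus. \<not> real_analytic_at_torus f \<zeta>)}"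
    unfolding dense_Gdelta_in_def using gdelta_in_nowhere_analytic[OF compact_cbox, where p = p]
    by (intro conjI dense) simp_all
qed

end
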